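(* Let $\mathcal{F}=\{f_\omega:\mathbb{R}^d\to\mathbb{R}\}$ be a discriminator class and $\mathcal{G}=\{g_\theta:\mathbb{R}^d\to\mathbb{R}^d\}$ a generator class such that $\mathcal{F}$ and $\mathcal{F}\circ\mathcal{G}$ are symmetric. Let $\pi$ be the distribution of the input $Z$, $\nu$ the target distribution of $X$, and for $g_\theta\in\mathcal{G}$ let $\mu_\theta$ be the distribution of $g_\theta(Z)$, $Z\sim\pi$. Let $$\widehat\theta_{m,n}\in\operatorname*{arg\,min}_{\theta:\,g_\theta\in\mathcal{G}}\ \max_{\omega:\,f_\omega\in\mathcal{F}}\Big\{\widehat{\mathbb{E}}_m f_\omega(g_\theta(Z))-\widehat{\mathbb{E}}_n f_\omega(X)\Big\}.$$ Then for any $\theta$ with $g_\theta\in\mathcal{G}$, $$d_{\mathcal{F}}\big(\mu_{\widehat\theta_{m,n}},\nu\big)\ \le\ d_{\mathcal{F}}(\mu_\theta,\nu)+2\,d_{\mathcal{F}}(\widehat\nu^n,\nu)+d_{\mathcal{F}}(\widehat\mu_\theta^m,\mu_\theta)+d_{\mathcal{F}\circ\mathcal{G}}(\widehat\pi^m,\pi).$$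
   Context: $\widehat{\mathbb{E}}_m$ denotes the empirical average over $m$ i.i.d. samples $Z_1,\dots,Z_m\sim\pi$ and $\widehat{\mathbb{E}}_n$ the empirical average over $n$ i.i.d. samples $X_1,\dots,X_n\sim\nu$. The empirical distributions are $\widehat\nu^n=\frac1n\sum_{i=1}^n\delta_{X_i}$, $\widehat\pi^m=\frac1m\sum_{j=1}^m\delta_{Z_j}$ and $\widehat\mu_\theta^m=\frac1m\sum_{j=1}^m\delta_{g_\theta(Z_j)}$ (the same samples as in the definition of $\widehat\theta_{m,n}$). $\mathcal{F}\circ\mathcal{G}=\{f\circ g: f\in\mathcal{F}, g\in\mathcal{G}\}$. A class $\mathcal{F}$ is symmetric if $\mathcal{F}=-\mathcal{F}$. $d_{\mathcal{F}}(\mu,\nu)=\sup_{f\in\mathcal{F}}\{\mathbb{E}_{Y\sim\mu}f(Y)-\mathbb{E}_{X\sim\nu}f(X)\}$, and likewise for $d_{\mathcal{F}\circ\mathcal{G}}$. *)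

theory Defs
  imports "HOL-Probability.Probability"
begin

text \<open>The integral probability metric may be infinite, hence the extended reals.\<close>

definition ipm :: "('a \<Rightarrow> real) set \<Rightarrow> 'a measure \<Rightarrow> 'a measure \<Rightarrow> ereal" where
  "ipm F \<mu> \<nu> = (SUP f\<in>F. ereal ((\<integral>y. f y \<partial>\<mu>) - (\<integral>x. f x \<partial>\<nu>)))"

definition symmetric_class :: "('a \<Rightarrow> real) set \<Rightarrow> bool" where
  "symmetric_class F \<longleftrightarrow> F = (\<lambda>f x. - f x) ` F"

definition comp_class :: "('b \<Rightarrow> 'c) set \<Rightarrow> ('a \<Rightarrow> 'b) set \<Rightarrow> ('a \<Rightarrow> 'c) set" where
  "comp_class F G = {f \<circ> g | f g. f \<in> F \<and> g \<in> G}"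

definition empirical_mean :: "nat \<Rightarrow> (nat \<Rightarrow> 'a) \<Rightarrow> ('a \<Rightarrow> real) \<Rightarrow> real" where
  "empirical_mean n x \<phi> = (\<Sum>i<n. \<phi> (x i)) / real n"

definition empirical_measure :: "nat \<Rightarrow> (nat \<Rightarrow> 'a) \<Rightarrow> 'a::topological_space measure" where
  "empirical_measure n x =
     measure_of UNIV (sets borel) (\<lambda>A. (\<Sum>i<n. emeasure (return borel (x i)) A) / of_nat n)"

text \<open>The set function passed to \<^const>\<open>measure_of\<close> above is a genuine measure when
  \<open>n > 0\<close>, so \<^const>\<open>empirical_measure\<close> does not fall into the default case.\<close>

lemma empirical_measure_eq_distr:
  assumes "n > 0"
  shows "empirical_measure n x = distr (uniform_count_measure {..<n}) borel x"
proof -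
  let ?D = "distr (uniform_count_measure {..<n}) borel x"
  have x: "x \<in> measurable (uniform_count_measure {..<n}) borel"
    by (auto simp: measurable_def space_uniform_count_measure sets_uniform_count_measure)
  have eq: "(\<Sum>i<n. emeasure (return borel (x i)) A) / of_nat n = emeasure ?D A"
    if A: "A \<in> sets borel" for A
  proof -
    have "(\<Sum>i<n. emeasure (return borel (x i)) A) = (\<Sum>i<n. indicator (x -` A) i)"
      using A by (intro sum.cong) (auto simp: indicator_def)
    also have "\<dots> = of_nat (card {i\<in>{..<n}. x i \<in> A})"
      by (simp add: indicator_def sum_of_bool_eq Int_def)
    finally have "(\<Sum>i<n. emeasure (return borel (x i)) A) = of_nat (card {i\<in>{..<n}. x i \<in> A})" .
    moreover have "emeasure (uniform_count_measure {..<n}) {i\<in>{..<n}. x i \<in> A}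
        = ennreal (card {i\<in>{..<n}. x i \<in> A} / n)"
      by (subst emeasure_uniform_count_measure) auto
    moreover have "x -` A \<inter> {..<n} = {i\<in>{..<n}. x i \<in> A}"
      by auto
    ultimately show ?thesis
      using A x assms
      by (simp add: emeasure_distr space_uniform_count_measure
          divide_ennreal ennreal_of_nat_eq_real_of_nat)
  qed
  have "empirical_measure n x = measure_of UNIV (sets borel) (emeasure ?D)"
    unfolding empirical_measure_def
    by (rule measure_of_eq) (auto simp: eq sets.sigma_sets_eq[of borel, simplified] simp del: emeasure_return)
  also have "\<dots> = ?D"
    using measure_of_of_measure[of ?D] by simp
  finally show ?thesis .
qed

lemma integral_empirical_measure:
  fixes x :: "nat \<Rightarrow> 'a::topological_space"
  assumes "n > 0" and "\<phi> \<in> borel_measurable borel"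
  shows "(\<integral>y. \<phi> y \<partial>empirical_measure n x) = empirical_mean n x \<phi>"
proof -
  have x: "x \<in> measurable (uniform_count_measure {..<n}) borel"
    by (auto simp: measurable_def space_uniform_count_measure sets_uniform_count_measure)
  show ?thesis
    using assms x
    by (simp add: empirical_measure_eq_distr integral_distr empirical_mean_def
        uniform_count_measure_def lebesgue_integral_point_measure_finite sum_divide_distrib)
qed

end

theory Submission
  imports Defs
begin

text \<open>The bound is an error decomposition for the minimax estimator. The metric \<^const>\<open>ipm\<close>
  satisfies the triangle inequality (\<open>ipm_triangle\<close>) and, for a symmetric class, is
  symmetric in its two measures (\<open>ipm_commute\<close>). Write \<open>\<mu>\<^sub>\<theta>\<close> for the law of
  \<open>g \<theta>\<close> under \<open>\<pi>\<close>, and a prime for the empirical version of a measure. The triangle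
  inequality leads from \<open>\<mu>\<^sub>h\<close>, the law generated by the estimator, to \<open>\<nu>\<close> through
  the empirical measures:
  \<^item> \<open>\<mu>\<^sub>h\<close> to \<open>\<mu>\<^sub>h'\<close>: the estimator depends on the very sample that defines
    \<open>\<mu>\<^sub>h'\<close>, so the distance must be bounded uniformly over the generators. Both measures are
    images of \<open>\<pi>\<close> and \<open>\<pi>'\<close> under one and the same generator, and moving that generator
    into the test function (\<open>ipm_distr_le_comp_class\<close>) gives the term for the composed class.
  \<^item> \<open>\<mu>\<^sub>h'\<close> to \<open>\<nu>'\<close>: the objective that the estimator minimises is exactly this
    distance (\<open>ipm_empirical_measure\<close>), so it does not exceed the one from \<open>\<mu>\<^sub>\<theta>'\<close> to \<open>\<nu>'\<close>. The latter goes back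
    through \<open>\<mu>\<^sub>\<theta>\<close> and \<open>\<nu>\<close>.
  \<^item> \<open>\<nu>'\<close> to \<open>\<nu>\<close>: with the return to \<open>\<nu>'\<close> in the previous step, this accounts for
    the factor 2.\<close>

text \<open>The supremum of a sum is at most the sum of the suprema. Infinite values are harmless: the
  bound is taken test function by test function, where all values are finite.\<close>

lemma ipm_triangle: "ipm F \<mu> \<nu> \<le> ipm F \<mu> \<rho> + ipm F \<rho> \<nu>"
  unfolding ipm_def
proof (rule SUP_least)
  fix f assume f: "f \<in> F"
  have "ereal (integral\<^sup>L \<mu> f - integral\<^sup>L \<nu> f)
      = ereal (integral\<^sup>L \<mu> f - integral\<^sup>L \<rho> f) + ereal (integral\<^sup>L \<rho> f - integral\<^sup>L \<nu> f)"
    by simp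
  also have "\<dots> \<le> (SUP f\<in>F. ereal (integral\<^sup>L \<mu> f - integral\<^sup>L \<rho> f))
      + (SUP f\<in>F. ereal (integral\<^sup>L \<rho> f - integral\<^sup>L \<nu> f))"
    using f by (intro add_mono SUP_upper)
  finally show "ereal (integral\<^sup>L \<mu> f - integral\<^sup>L \<nu> f) \<le> \<dots>" .
qed

lemma ipm_commute:
  assumes "symmetric_class F"
  shows "ipm F \<mu> \<nu> = ipm F \<nu> \<mu>"
proof -
  have "ipm F \<mu> \<nu> = ipm ((\<lambda>f x. - f x) ` F) \<mu> \<nu>"
    using assms by (simp add: symmetric_class_def)
  also have "\<dots> = ipm F \<nu> \<mu>"
    by (simp add: ipm_def image_image)
  finally show ?thesis .
qed

text \<open>Testing two image measures with \<open>f\<close> is testing the original measures with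
  \<open>f \<circ> g\<close>, so a single generator only sees part of the composed class.\<close>

lemma ipm_distr_le_comp_class:
  assumes "g \<in> G" and "g \<in> measurable \<mu> N" and "g \<in> measurable \<nu> N"
    and "\<And>f. f \<in> F \<Longrightarrow> f \<in> borel_measurable N"
  shows "ipm F (distr \<mu> N g) (distr \<nu> N g) \<le> ipm (comp_class F G) \<mu> \<nu>"
  unfolding ipm_def
proof (rule SUP_least)
  fix f assume f: "f \<in> F"
  have "f \<circ> g \<in> comp_class F G"
    using f assms(1) by (auto simp: comp_class_def)
  then show "ereal (integral\<^sup>L (distr \<mu> N g) f - integral\<^sup>L (distr \<nu> N g) f)
      \<le> (SUP h\<in>comp_class F G. ereal (integral\<^sup>L \<mu> h - integral\<^sup>L \<nu> h))"
    using assms f by (intro SUP_upper2[of "f \<circ> g"]) (simp_all add: integral_distr comp_def)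
qed

lemma distr_empirical_measure:
  fixes x :: "nat \<Rightarrow> 'a::topological_space" and g :: "'a \<Rightarrow> 'b::topological_space"
  assumes "n > 0" and "g \<in> borel_measurable borel"
  shows "distr (empirical_measure n x) borel g = empirical_measure n (\<lambda>i. g (x i))"
proof -
  have "x \<in> measurable (uniform_count_measure {..<n}) borel"
    by (auto simp: measurable_def space_uniform_count_measure sets_uniform_count_measure)
  with assms show ?thesis
    by (simp add: empirical_measure_eq_distr distr_distr comp_def)
qed

lemma sets_empirical_measure: "n > 0 \<Longrightarrow> sets (empirical_measure n x) = sets borel"
  by (simp add: empirical_measure_eq_distr)

lemma ipm_empirical_measure:
  fixes x y :: "nat \<Rightarrow> 'a::topological_space"
  assumes "m > 0" and "n > 0" and "\<And>f. f \<in> F \<Longrightarrow> f \<in> borel_measurable borel"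
  shows "ipm F (empirical_measure m x) (empirical_measure n y)
      = (SUP f\<in>F. ereal (empirical_mean m x f - empirical_mean n y f))"
  unfolding ipm_def using assms by (intro SUP_cong) (simp_all add: integral_empirical_measure)

theorem lemma12:
  fixes f :: "'w \<Rightarrow> real ^ 'd \<Rightarrow> real" and \<Omega> :: "'w set"
    and g :: "'t \<Rightarrow> real ^ 'd \<Rightarrow> real ^ 'd" and \<Theta> :: "'t set"
    and F :: "(real ^ 'd \<Rightarrow> real) set" and G :: "(real ^ 'd \<Rightarrow> real ^ 'd) set"
    and \<pi> \<nu> :: "(real ^ 'd) measure"
    and M :: "'s measure"
    and Z X :: "nat \<Rightarrow> 's \<Rightarrow> real ^ 'd"
    and m n :: nat
    and \<theta>_hat :: "'s \<Rightarrow> 't" and s :: 's and \<theta> :: 't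
  assumes F: "F = f ` \<Omega>" and G: "G = g ` \<Theta>"
    and sym_F: "symmetric_class F"
    and sym_FG: "symmetric_class (comp_class F G)"
    and \<pi>: "prob_space \<pi>" "sets \<pi> = sets borel"
    and \<nu>: "prob_space \<nu>" "sets \<nu> = sets borel"
    and g_measurable: "\<And>\<theta>. \<theta> \<in> \<Theta> \<Longrightarrow> g \<theta> \<in> borel_measurable borel"
    and f_integrable_\<nu>: "\<And>\<omega>. \<omega> \<in> \<Omega> \<Longrightarrow> integrable \<nu> (f \<omega>)"
    and f_integrable_\<mu>:
      "\<And>\<omega> \<theta>. \<omega> \<in> \<Omega> \<Longrightarrow> \<theta> \<in> \<Theta> \<Longrightarrow> integrable (distr \<pi> borel (g \<theta>)) (f \<omega>)"
    and mn: "m \<ge> 1" "n \<ge> 1"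
    and M: "prob_space M"
    and Z_indep: "prob_space.indep_vars M (\<lambda>_. borel) Z {..<m}"
    and Z_distr: "\<And>j. j < m \<Longrightarrow> distr M borel (Z j) = \<pi>"
    and X_indep: "prob_space.indep_vars M (\<lambda>_. borel) X {..<n}"
    and X_distr: "\<And>i. i < n \<Longrightarrow> distr M borel (X i) = \<nu>"
    and s: "s \<in> space M"
    and \<theta>_hat:
      "is_arg_min
         (\<lambda>\<theta>. SUP \<omega>\<in>\<Omega>. ereal (empirical_mean m (\<lambda>j. Z j s) (\<lambda>z. f \<omega> (g \<theta> z))
                                 - empirical_mean n (\<lambda>i. X i s) (f \<omega>)))
         (\<lambda>\<theta>. \<theta> \<in> \<Theta>) (\<theta>_hat s)"
    and \<theta>: "\<theta> \<in> \<Theta>"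
  shows "ipm F (distr \<pi> borel (g (\<theta>_hat s))) \<nu>
         \<le> ipm F (distr \<pi> borel (g \<theta>)) \<nu>
           + 2 * ipm F (empirical_measure n (\<lambda>i. X i s)) \<nu>
           + ipm F (empirical_measure m (\<lambda>j. g \<theta> (Z j s))) (distr \<pi> borel (g \<theta>))
           + ipm (comp_class F G) (empirical_measure m (\<lambda>j. Z j s)) \<pi>"
proof -
  let ?\<mu> = "\<lambda>\<theta>. distr \<pi> borel (g \<theta>)"
  let ?\<mu>' = "\<lambda>\<theta>. empirical_measure m (\<lambda>j. g \<theta> (Z j s))"
  let ?\<pi>' = "empirical_measure m (\<lambda>j. Z j s)"
  let ?\<nu>' = "empirical_measure n (\<lambda>i. X i s)"
  let ?h = "\<theta>_hat s"
  have pos: "m > 0" "n > 0"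
    using mn by auto
  have F_measurable: "\<phi> \<in> borel_measurable borel" if "\<phi> \<in> F" for \<phi>
    using that F borel_measurable_integrable[OF f_integrable_\<nu>] \<nu>(2)
    by (auto cong: measurable_cong_sets)
  have h: "?h \<in> \<Theta>"
    using \<theta>_hat by (simp add: is_arg_min_def)

  have objective: "(SUP \<omega>\<in>\<Omega>. ereal (empirical_mean m (\<lambda>j. Z j s) (\<lambda>z. f \<omega> (g t z))
      - empirical_mean n (\<lambda>i. X i s) (f \<omega>))) = ipm F (?\<mu>' t) ?\<nu>'" for t
    by (simp add: ipm_empirical_measure[OF pos F_measurable] F image_image empirical_mean_def)
  have optimal: "ipm F (?\<mu>' ?h) ?\<nu>' \<le> ipm F (?\<mu>' \<theta>) ?\<nu>'"
    using \<theta>_hat \<theta> unfolding objective is_arg_min_def by (auto simp: not_less)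

  have generator: "ipm F (?\<mu> ?h) (?\<mu>' ?h) \<le> ipm (comp_class F G) ?\<pi>' \<pi>"
  proof -
    have meas: "g ?h \<in> measurable ?\<pi>' borel" "g ?h \<in> measurable \<pi> borel"
      using g_measurable[OF h] \<pi>(2) sets_empirical_measure[OF pos(1), of "\<lambda>j. Z j s"]
      by (simp_all cong: measurable_cong_sets)
    have "ipm F (?\<mu> ?h) (?\<mu>' ?h) = ipm F (distr ?\<pi>' borel (g ?h)) (?\<mu> ?h)"
      by (simp add: ipm_commute[OF sym_F, of "?\<mu> ?h"] distr_empirical_measure pos g_measurable h)
    also have "\<dots> \<le> ipm (comp_class F G) ?\<pi>' \<pi>"
      using h G F_measurable by (intro ipm_distr_le_comp_class meas) auto
    finally show ?thesis .
  qed

  have "ipm F (?\<mu>' \<theta>) ?\<nu>' \<le> ipm F (?\<mu>' \<theta>) (?\<mu> \<theta>) + ipm F (?\<mu> \<theta>) ?\<nu>'"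
    by (rule ipm_triangle)
  also have "\<dots> \<le> ipm F (?\<mu>' \<theta>) (?\<mu> \<theta>) + (ipm F (?\<mu> \<theta>) \<nu> + ipm F ?\<nu>' \<nu>)"
    unfolding ipm_commute[OF sym_F, of ?\<nu>' \<nu>] by (intro add_left_mono ipm_triangle)
  finally have comparison: "ipm F (?\<mu>' \<theta>) ?\<nu>'
      \<le> ipm F (?\<mu>' \<theta>) (?\<mu> \<theta>) + (ipm F (?\<mu> \<theta>) \<nu> + ipm F ?\<nu>' \<nu>)" .

  have "ipm F (?\<mu> ?h) \<nu> \<le> ipm F (?\<mu> ?h) (?\<mu>' ?h) + ipm F (?\<mu>' ?h) \<nu>"
    by (rule ipm_triangle)
  also have "\<dots> \<le> ipm F (?\<mu> ?h) (?\<mu>' ?h) + (ipm F (?\<mu>' ?h) ?\<nu>' + ipm F ?\<nu>' \<nu>)"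
    by (intro add_left_mono ipm_triangle)
  also have "\<dots> \<le> ipm (comp_class F G) ?\<pi>' \<pi>
      + ((ipm F (?\<mu>' \<theta>) (?\<mu> \<theta>) + (ipm F (?\<mu> \<theta>) \<nu> + ipm F ?\<nu>' \<nu>)) + ipm F ?\<nu>' \<nu>)"
    by (intro add_mono generator order_trans[OF optimal comparison] order_refl)
  also have "\<dots> = ipm F (?\<mu> \<theta>) \<nu> + (ipm F ?\<nu>' \<nu> + ipm F ?\<nu>' \<nu>)
      + ipm F (?\<mu>' \<theta>) (?\<mu> \<theta>) + ipm (comp_class F G) ?\<pi>' \<pi>"
    by (simp only: add_ac)
  \<comment> \<open>Extended reals are not a semiring, so the doubling needs the infinite values separately.\<close>
  also have "ipm F ?\<nu>' \<nu> + ipm F ?\<nu>' \<nu> = 2 * ipm F ?\<nu>' \<nu>"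
    by (cases "ipm F ?\<nu>' \<nu>") simp_all
  finally show ?thesis .
qed

end
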